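(* For any triangle-free graph $G$ of girth at least $5$, $\beta(G)\leq\frac1{50}$.
   Context: All graphs are finite and simple. The girth of a graph is the length of its shortest cycle (infinite if there are no cycles). For a graph $G$ with $n\geq 1$ vertices, a half in $G$ is a function $\mu: V(G)\to[0,1]$ such that $\sum_{v\in V(G)}\mu(v)=n/2$. Put $\beta(G,\mu)=\frac1{n^2}\sum_{\{u,v\}\in E(G)}\mu(u)\mu(v)$ (each edge is counted once) and $\beta(G)=\min\{\beta(G,\mu): \mu \text{ is a half in } G\}$. *)

theory Defs
  imports "HOL-Analysis.Analysis"
begin

locale simple_graph =
  fixes V :: "'a set" and E :: "'a set set"
  assumes finite_verts: "finite V"
    and edges: "E \<subseteq> {e. e \<subseteq> V \<and> card e = 2}"

definition triangle_free :: "'a set set \<Rightarrow> bool" where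
  "triangle_free E \<longleftrightarrow> \<not> (\<exists>u v w. {u, v} \<in> E \<and> {v, w} \<in> E \<and> {u, w} \<in> E)"

text \<open>A cycle is given by the list of its vertices in cyclic order, without repeating the
  first vertex at the end, so the length of the list is the length of the cycle.\<close>

definition is_cycle :: "'a set set \<Rightarrow> 'a list \<Rightarrow> bool" where
  "is_cycle E p \<longleftrightarrow> 3 \<le> length p \<and> distinct p \<and>
     (\<forall>i<length p. {p ! i, p ! (Suc i mod length p)} \<in> E)"

text \<open>The infimum over the empty set is \<open>\<infinity>\<close>, as required for graphs without cycles.\<close>

definition girth :: "'a set set \<Rightarrow> enat" where
  "girth E = (INF p\<in>{p. is_cycle E p}. enat (length p))"

text \<open>The values of a half outside \<open>V\<close> are unconstrained; they do not enter
  \<open>beta_half\<close> below, because edges are subsets of \<open>V\<close>.\<close>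

definition is_half :: "'a set \<Rightarrow> ('a \<Rightarrow> real) \<Rightarrow> bool" where
  "is_half V \<mu> \<longleftrightarrow> \<mu> \<in> V \<rightarrow> {0..1} \<and> (\<Sum>v\<in>V. \<mu> v) = real (card V) / 2"

text \<open>An edge is a two-element set, so \<open>\<Prod>v\<in>e. \<mu> v\<close> is \<open>\<mu> u * \<mu> v\<close> for
  \<open>e = {u, v}\<close>, and each edge is counted once.\<close>

definition beta_half :: "'a set \<Rightarrow> 'a set set \<Rightarrow> ('a \<Rightarrow> real) \<Rightarrow> real" where
  "beta_half V E \<mu> = (\<Sum>e\<in>E. \<Prod>v\<in>e. \<mu> v) / (real (card V))\<^sup>2"

definition beta :: "'a set \<Rightarrow> 'a set set \<Rightarrow> real" where
  "beta V E = (LEAST b. \<exists>\<mu>. is_half V \<mu> \<and> b = beta_half V E \<mu>)"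

text \<open>\<open>LEAST\<close> is only meaningful if the minimum exists; it does, by compactness.\<close>

context simple_graph
begin

lemma ex_minimal_half:
  "\<exists>\<mu>. is_half V \<mu> \<and> (\<forall>\<nu>. is_half V \<nu> \<longrightarrow> beta_half V E \<mu> \<le> beta_half V E \<nu>)"
proof -
  define B :: "('a \<Rightarrow> real) set" where "B = (\<Pi>\<^sub>E v\<in>UNIV. if v \<in> V then {0..1} else {0})"
  define K where "K = B \<inter> {\<mu>. (\<Sum>v\<in>V. \<mu> v) = real (card V) / 2}"
  have eval: "continuous_on S (\<lambda>\<mu> :: 'a \<Rightarrow> real. \<mu> v)" for v S
    by (rule continuous_on_product_then_coordinatewise) (rule continuous_on_id)
  have "compactin (product_topology (\<lambda>v. euclidean) UNIV) B"
    unfolding B_def compactin_PiE by auto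
  hence "compact B"
    by (simp add: euclidean_product_topology)
  moreover have "closed {\<mu> :: 'a \<Rightarrow> real. (\<Sum>v\<in>V. \<mu> v) = real (card V) / 2}"
    by (intro closed_Collect_eq continuous_on_sum eval continuous_on_const)
  ultimately have "compact K"
    unfolding K_def by (rule compact_Int_closed)
  moreover have "(\<lambda>v. if v \<in> V then 1/2 else 0) \<in> K"
    by (auto simp: K_def B_def)
  hence "K \<noteq> {}" by blast
  moreover have "continuous_on K (beta_half V E)"
    unfolding beta_half_def divide_inverse
    by (intro continuous_on_mult continuous_on_sum continuous_on_prod eval continuous_on_const)
  ultimately obtain \<mu> where \<mu>: "\<mu> \<in> K" "\<And>\<nu>. \<nu> \<in> K \<Longrightarrow> beta_half V E \<mu> \<le> beta_half V E \<nu>"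
    by (metis continuous_attains_inf)
  have "is_half V \<mu>"
    using \<mu>(1) by (auto simp: K_def B_def is_half_def PiE_iff split: if_splits)
  moreover have "beta_half V E \<mu> \<le> beta_half V E \<nu>" if "is_half V \<nu>" for \<nu>
  proof -
    define \<nu>' where "\<nu>' = (\<lambda>v. if v \<in> V then \<nu> v else 0)"
    have "\<nu>' \<in> K"
      using that by (auto simp: K_def B_def is_half_def \<nu>'_def PiE_iff)
    moreover have "beta_half V E \<nu>' = beta_half V E \<nu>"
      unfolding beta_half_def \<nu>'_def using edges
      by (intro arg_cong2[where f = "(/)"] sum.cong prod.cong) auto
    ultimately show ?thesis
      using \<mu>(2) by metis
  qed
  ultimately show ?thesis by blast
qed

lemma beta_attained: "\<exists>\<mu>. is_half V \<mu> \<and> beta V E = beta_half V E \<mu>"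
  and beta_le: "is_half V \<nu> \<Longrightarrow> beta V E \<le> beta_half V E \<nu>"
proof -
  obtain \<mu> where \<mu>: "is_half V \<mu>" "\<And>\<nu>. is_half V \<nu> \<Longrightarrow> beta_half V E \<mu> \<le> beta_half V E \<nu>"
    using ex_minimal_half by blast
  have "beta V E = beta_half V E \<mu>"
    unfolding beta_def using \<mu> by (intro Least_equality) auto
  with \<mu> show "\<exists>\<mu>. is_half V \<mu> \<and> beta V E = beta_half V E \<mu>"
    and "is_half V \<nu> \<Longrightarrow> beta V E \<le> beta_half V E \<nu>" by auto
qed

end

end

theory Submission
  imports Defs "HOL-Library.Code_Binary_Nat"
begin

text \<open>Counting paths of length two gives \<open>4 e\<^sup>2 \<le> n\<^sup>2 (n - 1)\<close> for the number \<open>e\<close> of edges, so for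
  \<open>n \<ge> 39\<close> the constant half \<open>1/2\<close> is sparse enough. For smaller \<open>n\<close>, suppose that every half is
  too dense. Then every set of about \<open>n/2\<close> vertices spans many edges, and deleting vertices of large
  degree turns this into lower bounds on the number of edges spanned by larger and larger vertex
  sets. Averaging over single deletions is not quite enough for this; one also uses that enough
  vertices of maximum degree contain several independent ones (no triangles), whose
  deletions do not interfere. The resulting bound on \<open>e\<close> contradicts the upper bound.\<close>

section \<open>Induced edges, degrees and independent sets\<close>

context simple_graph
begin

definition induced :: "'a set \<Rightarrow> 'a set set" where
  "induced W = {e \<in> E. e \<subseteq> W}"

text \<open>Counting edges instead of neighbours makes this zero for \<open>v \<notin> W\<close>, so
  \<open>card_induced_remove\<close> holds for every \<open>v\<close>.\<close>

definition degree_in :: "'a set \<Rightarrow> 'a \<Rightarrow> nat" where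
  "degree_in W v = card {e \<in> E. e \<subseteq> W \<and> v \<in> e}"

definition independent :: "'a set \<Rightarrow> bool" where
  "independent S \<longleftrightarrow> (\<forall>x\<in>S. \<forall>y\<in>S. {x, y} \<notin> E)"

text \<open>For \<open>m > card V\<close> this holds vacuously, so bounds can be propagated without
  comparing \<open>m\<close> to \<open>card V\<close>.\<close>

definition spans :: "nat \<Rightarrow> nat \<Rightarrow> bool" where
  "spans m s \<longleftrightarrow> (\<forall>W\<subseteq>V. card W = m \<longrightarrow> s \<le> card (induced W))"

lemma finite_edges: "finite E"
proof (rule finite_subset)
  show "E \<subseteq> Pow V" using edges by auto
  show "finite (Pow V)" using finite_verts by simp
qed

lemma edge_card: "e \<in> E \<Longrightarrow> card e = 2"
  using edges by auto

lemma edge_subset: "e \<in> E \<Longrightarrow> e \<subseteq> V"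
  using edges by auto

lemma singleton_not_edge: "{x} \<notin> E"
  using edge_card by fastforce

lemma finite_induced: "finite (induced W)"
  using finite_edges by (simp add: induced_def)

lemma induced_verts: "induced V = E"
  using edge_subset by (auto simp: induced_def)

lemma card_induced_remove: "card (induced W) = card (induced (W - {v})) + degree_in W v"
proof -
  have "induced W = induced (W - {v}) \<union> {e \<in> E. e \<subseteq> W \<and> v \<in> e}"
    by (auto simp: induced_def)
  moreover have "induced (W - {v}) \<inter> {e \<in> E. e \<subseteq> W \<and> v \<in> e} = {}"
    by (auto simp: induced_def)
  ultimately show ?thesis
    using finite_edges by (simp add: card_Un_disjoint finite_induced degree_in_def)
qed

text \<open>Handshake identity inside \<open>W\<close>: incidences are counted by vertices and by
  edges.\<close>

lemma sum_degree_in: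
  assumes "W \<subseteq> V"
  shows "(\<Sum>v\<in>W. degree_in W v) = 2 * card (induced W)"
proof -
  have fin: "finite W"
    using assms finite_verts finite_subset by blast
  have "(\<Sum>v\<in>W. degree_in W v) = (\<Sum>v\<in>W. \<Sum>e\<in>induced W. if v \<in> e then 1 else 0)"
    by (intro sum.cong refl)
      (auto simp: degree_in_def induced_def sum.If_cases finite_edges intro!: arg_cong[where f = card])
  also have "\<dots> = (\<Sum>e\<in>induced W. \<Sum>v\<in>W. if v \<in> e then 1 else 0)"
    by (rule sum.swap)
  also have "\<dots> = (\<Sum>e\<in>induced W. 2)"
  proof (intro sum.cong refl)
    fix e assume "e \<in> induced W"
    hence "W \<inter> e = e" "card e = 2"
      using edge_card by (auto simp: induced_def)
    thus "(\<Sum>v\<in>W. if v \<in> e then 1 else 0) = (2::nat)"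
      using fin by (simp add: sum.If_cases)
  qed
  finally show ?thesis by simp
qed

lemma degree_in_nbrs:
  assumes "W \<subseteq> V" "v \<in> W"
  shows "degree_in W v = card {u \<in> W. {u, v} \<in> E}"
proof -
  have "{e \<in> E. e \<subseteq> W \<and> v \<in> e} = (\<lambda>u. {u, v}) ` {u \<in> W. {u, v} \<in> E}"
  proof safe
    fix e assume e: "e \<in> E" "e \<subseteq> W" "v \<in> e"
    then obtain a b where "e = {a, b}"
      using edge_card by (meson card_2_iff)
    with e obtain u where "e = {u, v}"
      by auto
    with e show "e \<in> (\<lambda>u. {u, v}) ` {u \<in> W. {u, v} \<in> E}"
      by auto
  qed (use assms in auto)
  moreover have "inj_on (\<lambda>u. {u, v}) {u \<in> W. {u, v} \<in> E}"
    by (auto simp: inj_on_def doubleton_eq_iff)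
  ultimately show ?thesis
    by (simp add: degree_in_def card_image)
qed

lemma degree_in_minus_nonadjacent:
  assumes "x \<notin> S" "\<And>y. y \<in> S \<Longrightarrow> {x, y} \<notin> E"
  shows "degree_in (W - S) x = degree_in W x"
proof -
  have disj: "e \<inter> S = {}" if e: "e \<in> E" "x \<in> e" for e
  proof (rule ccontr)
    assume "e \<inter> S \<noteq> {}"
    then obtain y where y: "y \<in> e" "y \<in> S" by blast
    have "x \<noteq> y" using y(2) assms(1) by blast
    with e y have "e = {x, y}"
      using edge_card[OF e(1)] by (metis card_2_iff doubleton_eq_iff insertE singletonD)
    with e y assms(2) show False by blast
  qed
  have "{e \<in> E. e \<subseteq> W - S \<and> x \<in> e} = {e \<in> E. e \<subseteq> W \<and> x \<in> e}"
    using disj by fast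
  thus ?thesis
    by (simp add: degree_in_def)
qed

text \<open>Deleting one member leaves the degrees of the others unchanged, since no edge joins
  them; hence the losses add up.\<close>

lemma card_induced_minus_independent:
  assumes "finite S" "independent S"
  shows "card (induced W) = card (induced (W - S)) + (\<Sum>x\<in>S. degree_in W x)"
  using assms
proof (induction S)
  case (insert x S)
  have "card (induced (W - S)) = card (induced (W - S - {x})) + degree_in (W - S) x"
    by (rule card_induced_remove)
  also have "degree_in (W - S) x = degree_in W x"
    using insert by (intro degree_in_minus_nonadjacent) (auto simp: independent_def)
  also have "W - S - {x} = W - insert x S" by blast
  finally show ?case
    using insert by (simp add: independent_def)
qed simp

text \<open>Either some vertex has many neighbours, which are independent as there are no triangles,
  or it can be put aside together with its few neighbours.\<close>

lemma ex_independent_subset: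
  assumes "triangle_free E" "finite S" "k * (k + 1) div 2 \<le> card S"
  shows "\<exists>I\<subseteq>S. card I = k \<and> independent I"
  using assms(2,3)
proof (induction k arbitrary: S)
  case 0
  show ?case by (intro exI[of _ "{}"]) (auto simp: independent_def)
next
  case (Suc k)
  have tri: "Suc k * (Suc k + 1) div 2 = k * (k + 1) div 2 + Suc k"
    by (simp add: algebra_simps)
  with Suc.prems have "S \<noteq> {}" by auto
  then obtain v where v: "v \<in> S" by blast
  define N where "N = {u \<in> S. {u, v} \<in> E}"
  have N: "N \<subseteq> S - {v}" "finite N"
    using Suc.prems singleton_not_edge by (auto simp: N_def)
  show ?case
  proof (cases "Suc k \<le> card N")
    case True
    then obtain I where I: "I \<subseteq> N" "card I = Suc k"
      by (meson obtain_subset_with_card_n)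
    have "independent I"
      using I assms(1) unfolding independent_def triangle_free_def N_def
      by (metis (no_types, lifting) insert_commute mem_Collect_eq subset_iff)
    with I N show ?thesis by blast
  next
    case False
    let ?S = "S - insert v N"
    have "v \<notin> N" "insert v N \<subseteq> S"
      using N v by auto
    moreover from this have "card (insert v N) = Suc (card N)"
      using N by simp
    ultimately have "card ?S = card S - Suc (card N)"
      using N by (simp add: card_Diff_subset)
    \<comment> \<open>\<open>v\<close> and at most \<open>k\<close> neighbours are removed, and
      \<open>Suc k\<close> is exactly the gap between consecutive triangular numbers.\<close>
    with False tri Suc.prems have "k * (k + 1) div 2 \<le> card ?S" by linarith
    then obtain I where I: "I \<subseteq> ?S" "card I = k" "independent I"
      using Suc.IH[of ?S] Suc.prems by auto
    have "{u, v} \<notin> E" if "u \<in> I" for u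
      using I(1) that by (auto simp: N_def)
    moreover have "{v, u} = {u, v}" for u
      by blast
    ultimately have "independent (insert v I)"
      using I(3) singleton_not_edge by (auto simp: independent_def)
    moreover have "card (insert v I) = Suc k"
      using I Suc.prems(1) finite_subset[of I S] by (subst card_insert_disjoint) auto
    ultimately show ?thesis
      using I v by (intro exI[of _ "insert v I"]) auto
  qed
qed

section \<open>Lower bounds from vertex deletion\<close>

lemma spans_minus:
  assumes "spans m a" "W \<subseteq> V" "I \<subseteq> W" "card W = m + card I"
  shows "a \<le> card (induced (W - I))"
proof -
  have "finite I"
    using assms finite_verts by (meson finite_subset)
  hence "card (W - I) = m"
    using assms by (simp add: card_Diff_subset)
  thus ?thesis
    using assms(1,2) unfolding spans_def by blast
qed

lemma spans_remove:
  assumes "spans m a" "W \<subseteq> V" "card W = Suc m" "v \<in> W"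
  shows "a + degree_in W v \<le> card (induced W)"
proof -
  have "a \<le> card (induced (W - {v}))"
    using assms by (intro spans_minus[of m]) auto
  thus ?thesis using card_induced_remove[of W v] by simp
qed

text \<open>Sum \<open>spans_remove\<close> over all \<open>v \<in> W\<close> and apply the
  handshake identity. For \<open>m > 1\<close> this bounds the edges from below by
  \<open>Suc m * a / (m - 1)\<close>.\<close>

lemma spans_average:
  assumes "spans m a" "W \<subseteq> V" "card W = Suc m"
  shows "Suc m * a + 2 * card (induced W) \<le> Suc m * card (induced W)"
proof -
  have "a + degree_in W v \<le> card (induced W)" if "v \<in> W" for v
    using assms that by (rule spans_remove)
  hence "(\<Sum>v\<in>W. a + degree_in W v) \<le> (\<Sum>v\<in>W. card (induced W))"
    by (rule sum_mono)
  thus ?thesis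
    using assms by (simp add: sum.distrib sum_degree_in)
qed

text \<open>A degree \<open>D\<close> exceeds \<open>D - 1\<close> by one, so a degree sum well
  above \<open>(D - 1) * card W\<close> forces many vertices of degree exactly
  \<open>D\<close>.\<close>

lemma card_max_degree:
  assumes "W \<subseteq> V" "\<And>v. v \<in> W \<Longrightarrow> degree_in W v \<le> D"
  shows "2 * card (induced W) \<le> (D - 1) * card W + card {v \<in> W. degree_in W v = D}"
proof -
  have fin: "finite W"
    using assms(1) finite_verts finite_subset by blast
  have "2 * card (induced W) = (\<Sum>v\<in>W. degree_in W v)"
    using sum_degree_in assms(1) by simp
  also have "\<dots> \<le> (\<Sum>v\<in>W. (D - 1) + (if degree_in W v = D then 1 else 0))"
    using assms(2) by (intro sum_mono) (force simp: le_less)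
  also have "\<dots> = (D - 1) * card W + card {v \<in> W. degree_in W v = D}"
    using fin by (simp add: sum.distrib sum.If_cases Int_def)
  finally show ?thesis .
qed

lemma ex_independent_max_degree:
  assumes "triangle_free E" "W \<subseteq> V" "\<And>v. v \<in> W \<Longrightarrow> degree_in W v \<le> D"
    and "(D - 1) * card W + j * (j + 1) div 2 \<le> 2 * card (induced W)"
  shows "\<exists>I\<subseteq>W. card I = j \<and> independent I \<and> (\<forall>v\<in>I. degree_in W v = D)"
proof -
  have "j * (j + 1) div 2 \<le> card {v \<in> W. degree_in W v = D}"
    using card_max_degree[OF assms(2,3)] assms(4) by simp
  moreover have "finite {v \<in> W. degree_in W v = D}"
    using finite_subset[OF assms(2) finite_verts] by simp
  ultimately obtain I where I: "I \<subseteq> {v \<in> W. degree_in W v = D}" "card I = j" "independent I"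
    using ex_independent_subset[OF assms(1)] by meson
  have "I \<subseteq> W" "\<forall>v\<in>I. degree_in W v = D"
    using I(1) by auto
  with I show ?thesis by blast
qed

text \<open>A vertex of degree above \<open>D\<close> or \<open>j\<close> independent vertices of degree \<open>D\<close> could be deleted.\<close>

lemma card_induced_neq:
  assumes "triangle_free E" "W \<subseteq> V" "card W = Suc m" "spans m a" "x \<le> a + D"
    and "spans (Suc m - j) b" "x < b + j * D" "(D - 1) * Suc m + j * (j + 1) div 2 \<le> 2 * x"
  shows "card (induced W) \<noteq> x"
proof
  assume x: "card (induced W) = x"
  have "degree_in W v \<le> D" if "v \<in> W" for v
    using spans_remove[OF assms(4,2,3) that] x assms(5) by simp
  then obtain I where I: "I \<subseteq> W" "card I = j" "independent I" "\<forall>v\<in>I. degree_in W v = D"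
    using ex_independent_max_degree[OF assms(1,2), of D j] assms(3,8) x by metis
  have fin: "finite W"
    using finite_subset[OF assms(2) finite_verts] .
  hence "finite I"
    using I(1) finite_subset by blast
  hence "card (induced W) = card (induced (W - I)) + j * D"
    using card_induced_minus_independent[of I W] I by simp
  moreover have "b \<le> card (induced (W - I))"
    \<comment> \<open>\<open>I \<subseteq> W\<close> yields \<open>j \<le> Suc m\<close>, so the
      truncated subtraction \<open>Suc m - j\<close> is exact.\<close>
    using I(1,2) card_mono[OF fin I(1)] assms(3)
    by (intro spans_minus[OF assms(6,2)]) auto
  ultimately show False using x assms(7) by simp
qed

end

text \<open>The \<open>i\<close>th entry of \<open>ts\<close> is a lower bound on the number of edges spanned by \<open>m - 1 - i\<close> vertices;
  then \<open>next_bound m ts\<close> is one for \<open>m\<close> vertices: the rounded-up average, plus one if the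
  average itself is impossible by \<open>card_induced_neq\<close>. The numbers 2 and 4 of simultaneous
  deletions were found by experiment to suffice.\<close>

definition excluded :: "nat \<Rightarrow> nat list \<Rightarrow> nat \<Rightarrow> bool" where
  "excluded m ts x = (let D = (2 * x + m - 1) div m in x \<le> hd ts + D \<and>
     (\<exists>j\<in>{2, 4}. j \<le> length ts \<and> x < ts ! (j - 1) + j * D \<and> (D - 1) * m + j * (j + 1) div 2 \<le> 2 * x))"

definition next_bound :: "nat \<Rightarrow> nat list \<Rightarrow> nat" where
  "next_bound m ts = (let x = (m * hd ts + m - 3) div (m - 2) in if excluded m ts x then Suc x else x)"

text \<open>The test \<open>k = 0\<close> in place of constructor patterns lets the equation unfold
  on numerals. As a default simp rule it could unfold without end for a variable
  \<open>k\<close>.\<close>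

fun bounds :: "nat \<Rightarrow> nat list \<Rightarrow> nat \<Rightarrow> nat list" where
  "bounds m ts k = (if k = 0 then ts else bounds (Suc m) (next_bound (Suc m) ts # ts) (k - 1))"

declare bounds.simps [simp del]

section \<open>Correctness of the recursion\<close>

context simple_graph
begin

text \<open>The conjunct \<open>i \<le> m\<close> keeps the truncated subtraction
  \<open>m - i\<close> exact.\<close>

definition valid_bounds :: "nat \<Rightarrow> nat list \<Rightarrow> bool" where
  "valid_bounds m ts \<longleftrightarrow> ts \<noteq> [] \<and> (\<forall>i<length ts. i \<le> m \<and> spans (m - i) (ts ! i))"

lemma valid_bounds_next:
  assumes "triangle_free E" "valid_bounds m ts" "2 \<le> m"
  shows "valid_bounds (Suc m) (next_bound (Suc m) ts # ts)"
proof -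
  have hd: "spans m (hd ts)"
    using assms(2) by (auto simp: valid_bounds_def hd_conv_nth)
  have "next_bound (Suc m) ts \<le> card (induced W)" if W: "W \<subseteq> V" "card W = Suc m" for W
  proof -
    define x where "x = (Suc m * hd ts + Suc m - 3) div (Suc m - 2)"
    let ?e = "card (induced W)"
    obtain k where k: "m = k + 2"
      using assms(3) by (metis add.commute le_Suc_ex)
    have "Suc m * hd ts \<le> (k + 1) * ?e"
      using spans_average[OF hd W] k by (simp add: algebra_simps)
    \<comment> \<open>Adding \<open>k\<close> before dividing by \<open>k + 1\<close> rounds up, so
      \<open>x\<close> is the ceiling of the averaging bound.\<close>
    hence "Suc m * hd ts + k < (?e + 1) * (k + 1)"
      by (simp add: algebra_simps)
    hence "(Suc m * hd ts + k) div (k + 1) < ?e + 1"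
      by (rule less_mult_imp_div_less)
    hence x: "x \<le> ?e"
      using k by (simp add: x_def algebra_simps)
    have "?e \<noteq> x" if ex: "excluded (Suc m) ts x"
    proof -
      \<comment> \<open>\<open>D\<close> is the ceiling of the average degree
        \<open>2 * x / Suc m\<close>, the smallest value which that average permits for the maximum
        degree.\<close>
      define D where "D = (2 * x + Suc m - 1) div Suc m"
      from ex obtain j where j: "j \<in> {2, 4}" "j \<le> length ts" "x < ts ! (j - 1) + j * D"
          "(D - 1) * Suc m + j * (j + 1) div 2 \<le> 2 * x" and D: "x \<le> hd ts + D"
        unfolding excluded_def Let_def D_def by blast
      \<comment> \<open>Entry \<open>j - 1\<close> of \<open>ts\<close> concerns
        \<open>Suc m - j\<close> vertices, which is what remains after deleting \<open>j\<close> of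
        \<open>Suc m\<close>.\<close>
      have "j - 1 \<le> m \<and> spans (m - (j - 1)) (ts ! (j - 1))"
        using assms(2) j unfolding valid_bounds_def by auto
      moreover have "m - (j - 1) = Suc m - j"
        using j(1) by auto
      ultimately show ?thesis
        using card_induced_neq[OF assms(1) W hd D _ j(3,4)] by simp
    qed
    with x show ?thesis
      by (auto simp: next_bound_def Let_def x_def)
  qed
  hence "spans (Suc m) (next_bound (Suc m) ts)"
    by (simp add: spans_def)
  thus ?thesis
    using assms(2) by (auto simp: valid_bounds_def nth_Cons' less_Suc_eq_0_disj)
qed

lemma valid_bounds_bounds:
  assumes "triangle_free E" "valid_bounds m ts" "2 \<le> m"
  shows "valid_bounds (m + k) (bounds m ts k)"
  using assms(2,3)
proof (induction k arbitrary: m ts)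
  case (Suc k)
  have "valid_bounds (Suc m + k) (bounds (Suc m) (next_bound (Suc m) ts # ts) k)"
    using Suc valid_bounds_next[OF assms(1)] by (intro Suc.IH) auto
  thus ?case by (subst bounds.simps) simp
qed (simp add: bounds.simps)

end

section \<open>Halves and initial bounds\<close>

context simple_graph
begin

lemma beta_uniform_half: "V \<noteq> {} \<Longrightarrow> beta V E \<le> (card E / 4) / (real (card V))\<^sup>2"
proof -
  assume "V \<noteq> {}"
  have "(\<Prod>v\<in>e. 1/2 :: real) = 1/4" if "e \<in> E" for e
    using edge_card[OF that] by (simp add: power2_eq_square)
  hence "(\<Sum>e\<in>E. \<Prod>v\<in>e. 1/2 :: real) = (\<Sum>e\<in>E. 1/4)"
    by (rule sum.cong[OF refl])
  also have "\<dots> = card E / 4"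
    by simp
  finally have "beta_half V E (\<lambda>_. 1/2) = (card E / 4) / (real (card V))\<^sup>2"
    by (simp only: beta_half_def)
  moreover have "is_half V (\<lambda>_. 1/2)"
    by (auto simp: is_half_def)
  ultimately show ?thesis
    using beta_le by metis
qed

text \<open>The half is 1 on \<open>W - {v}\<close>, \<open>c\<close> at \<open>v\<close> and 0
  elsewhere. Even orders use \<open>c = 1\<close>, odd ones \<open>c = 1/2\<close>.\<close>

lemma beta_fractional_vertex:
  fixes c :: real
  assumes "W \<subseteq> V" "v \<in> W" "0 \<le> c" "c \<le> 1" "real (card W) - 1 + c = real (card V) / 2"
  shows "beta V E * (real (card V))\<^sup>2 \<le> card (induced (W - {v})) + c * degree_in W v"
proof -
  define \<mu> where "\<mu> = (\<lambda>u. if u = v then c else if u \<in> W then 1 else 0)"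
  have fin: "finite W"
    using finite_subset[OF assms(1) finite_verts] .
  have "(\<Sum>u\<in>V. \<mu> u) = (\<Sum>u\<in>W. \<mu> u)"
    using assms(1,2) finite_verts by (intro sum.mono_neutral_right) (auto simp: \<mu>_def)
  also have "\<dots> = c + (\<Sum>u\<in>W - {v}. \<mu> u)"
    using fin assms(2) by (simp add: sum.remove[of W v] \<mu>_def)
  also have "(\<Sum>u\<in>W - {v}. \<mu> u) = (\<Sum>u\<in>W - {v}. 1)"
    by (intro sum.cong) (auto simp: \<mu>_def)
  also have "c + \<dots> = real (card V) / 2"
    using assms(2,5) fin card_gt_0_iff[of W] by (auto simp: of_nat_diff Suc_le_eq)
  finally have "is_half V \<mu>"
    using assms(3,4) by (auto simp: is_half_def \<mu>_def)
  hence "beta V E \<le> beta_half V E \<mu>"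
    by (rule beta_le)
  moreover have "(\<Sum>e\<in>E. \<Prod>u\<in>e. \<mu> u) = card (induced (W - {v})) + c * degree_in W v"
  proof -
    have "(\<Prod>u\<in>e. \<mu> u) = (if e \<subseteq> W - {v} then 1 else 0) + (if e \<subseteq> W \<and> v \<in> e then c else 0)"
      if e: "e \<in> E" for e
    proof -
      have fe: "finite e"
        using edge_card[OF e] by (simp add: card_ge_0_finite)
      consider "\<not> e \<subseteq> W" | "e \<subseteq> W - {v}" | "e \<subseteq> W" "v \<in> e" by blast
      thus ?thesis
      proof cases
        case 1
        then obtain u where "u \<in> e" "u \<notin> W" by blast
        hence "\<mu> u = 0" using assms(2) by (auto simp: \<mu>_def)
        hence "(\<Prod>u\<in>e. \<mu> u) = 0"
          using fe \<open>u \<in> e\<close> by (meson prod_zero)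
        with 1 show ?thesis by auto
      next
        case 2
        have "(\<Prod>u\<in>e. \<mu> u) = (\<Prod>u\<in>e. 1)"
          using 2 by (intro prod.cong) (auto simp: \<mu>_def)
        with 2 show ?thesis by auto
      next
        case 3
        have "(\<Prod>u\<in>e. \<mu> u) = \<mu> v * (\<Prod>u\<in>e - {v}. \<mu> u)"
          using fe 3 by (simp add: prod.remove)
        also have "(\<Prod>u\<in>e - {v}. \<mu> u) = (\<Prod>u\<in>e - {v}. 1)"
          using 3 by (intro prod.cong) (auto simp: \<mu>_def)
        finally show ?thesis using 3 by (auto simp: \<mu>_def)
      qed
    qed
    hence "(\<Sum>e\<in>E. \<Prod>u\<in>e. \<mu> u) =
        (\<Sum>e\<in>E. (if e \<subseteq> W - {v} then 1 else 0) + (if e \<subseteq> W \<and> v \<in> e then c else 0))"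
      by (rule sum.cong[OF refl])
    also have "\<dots> = card (induced (W - {v})) + c * degree_in W v"
      using finite_edges
      by (simp add: sum.distrib sum.If_cases induced_def degree_in_def Int_def)
    finally show ?thesis .
  qed
  moreover have "card V > 0"
    using assms(1,2) finite_verts card_gt_0_iff by blast
  ultimately show ?thesis
    by (simp add: beta_half_def field_simps)
qed

text \<open>With \<open>c = 1\<close> the half is the indicator of \<open>W\<close>; strictness
  gives the \<open>+ 1\<close> even if 50 divides \<open>(card V)\<^sup>2\<close>.\<close>

lemma spans_half:
  assumes "beta V E > 1 / 50" "card V = 2 * h" "h > 0"
  shows "spans h ((card V)\<^sup>2 div 50 + 1)"
  unfolding spans_def
proof (intro allI impI)
  fix W assume W: "W \<subseteq> V" "card W = h"
  then obtain v where v: "v \<in> W"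
    using assms(3) by fastforce
  have "(real (card V))\<^sup>2 / 50 < beta V E * (real (card V))\<^sup>2"
    using assms by simp
  also have "\<dots> \<le> real (card (induced (W - {v}))) + 1 * real (degree_in W v)"
    using W v assms by (intro beta_fractional_vertex) auto
  also have "\<dots> = card (induced W)"
    using card_induced_remove[of W v] by simp
  finally have "real ((card V)\<^sup>2) < real (50 * card (induced W))"
    by simp
  hence "(card V)\<^sup>2 < card (induced W) * 50"
    by linarith
  thus "(card V)\<^sup>2 div 50 + 1 \<le> card (induced W)"
    using less_mult_imp_div_less[of "(card V)\<^sup>2" "card (induced W)" 50] by simp
qed

text \<open>With weight \<open>1/2\<close> at \<open>v\<close>, doubling the density bound counts
  edges at \<open>v\<close> once and the other edges of \<open>W\<close> twice.\<close>

lemma half_odd_bound: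
  assumes "beta V E > 1 / 50" "card V + 1 = 2 * h" "W \<subseteq> V" "card W = h" "v \<in> W"
  shows "(card V)\<^sup>2 div 25 + 1 + degree_in W v \<le> 2 * card (induced W)"
proof -
  have "card V > 0"
    using assms(3,5) finite_verts card_gt_0_iff by blast
  hence "(real (card V))\<^sup>2 / 50 < beta V E * (real (card V))\<^sup>2"
    using assms(1) by simp
  also have "\<dots> \<le> card (induced (W - {v})) + 1/2 * degree_in W v"
  proof (rule beta_fractional_vertex)
    have "real (card V) + 1 = 2 * real h"
      using assms(2) by (metis of_nat_1 of_nat_add of_nat_mult of_nat_numeral)
    thus "real (card W) - 1 + 1/2 = real (card V) / 2"
      using assms(4) by simp
  qed (use assms in auto)
  finally have "real ((card V)\<^sup>2) < real (25 * (2 * card (induced (W - {v})) + degree_in W v))"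
    by simp
  hence "(card V)\<^sup>2 < (2 * card (induced (W - {v})) + degree_in W v) * 25"
    by linarith
  hence "(card V)\<^sup>2 div 25 < 2 * card (induced (W - {v})) + degree_in W v"
    by (rule less_mult_imp_div_less)
  thus ?thesis
    using card_induced_remove[of W v] by simp
qed

text \<open>Summing \<open>half_odd_bound\<close> over \<open>v \<in> W\<close> gives
  \<open>h * ?t \<le> (card V - 1) * ?e\<close>, as \<open>2 * h - 2 = card V - 1\<close>; the
  summand \<open>card V - 2\<close> rounds the quotient up.\<close>

lemma spans_half_odd:
  assumes "beta V E > 1 / 50" "card V + 1 = 2 * h" "h > 1"
  shows "spans h ((h * ((card V)\<^sup>2 div 25 + 1) + card V - 2) div (card V - 1))"
  unfolding spans_def
proof (intro allI impI)
  fix W assume W: "W \<subseteq> V" "card W = h"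
  let ?e = "card (induced W)" and ?t = "(card V)\<^sup>2 div 25 + 1"
  have "(\<Sum>v\<in>W. ?t + degree_in W v) \<le> (\<Sum>v\<in>W. 2 * ?e)"
    using half_odd_bound[OF assms(1,2) W] by (rule sum_mono)
  hence *: "h * ?t + 2 * ?e \<le> h * (2 * ?e)"
    by (simp only: sum.distrib sum_degree_in[OF W(1)] sum_constant W(2) of_nat_id distrib_left)
  obtain k where k: "h = k + 2"
    using assms(3) by (metis add.commute less_iff_Suc_add add_2_eq_Suc' add_Suc_right plus_1_eq_Suc)
  have n: "card V = 2 * k + 3"
    using assms(2) k by simp
  have "h * ?t \<le> (2 * k + 2) * ?e"
    using * unfolding k by (simp add: algebra_simps)
  hence "h * ?t + card V - 2 < (?e + 1) * (card V - 1)"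
    unfolding n by (simp add: algebra_simps)
  hence "(h * ?t + card V - 2) div (card V - 1) < ?e + 1"
    by (rule less_mult_imp_div_less)
  thus "(h * ?t + card V - 2) div (card V - 1) \<le> ?e"
    by simp
qed

section \<open>Upper bound on the number of edges\<close>

text \<open>Two common neighbours \<open>u\<close> and \<open>w\<close> would close the 4-cycle
  \<open>[x, u, y, w]\<close>.\<close>

lemma card_common_nbrs:
  assumes "girth E \<ge> 5" "x \<noteq> y"
  shows "card {u \<in> V. {u, x} \<in> E \<and> {u, y} \<in> E} \<le> 1"
proof (rule ccontr)
  let ?N = "{u \<in> V. {u, x} \<in> E \<and> {u, y} \<in> E}"
  assume "\<not> card ?N \<le> 1"
  moreover have fin: "finite ?N" using finite_verts by simp
  ultimately have "\<not> (\<forall>u\<in>?N. \<forall>w\<in>?N. u = w)"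
    using card_le_Suc0_iff_eq[OF fin] by simp
  then obtain u w where "u \<in> ?N" "w \<in> ?N" and "u \<noteq> w"
    by blast
  hence uw: "u \<noteq> w" "{u, x} \<in> E" "{u, y} \<in> E" "{w, x} \<in> E" "{w, y} \<in> E"
    by simp_all
  have ne: "u \<noteq> x" "u \<noteq> y" "w \<noteq> x" "w \<noteq> y"
    using uw singleton_not_edge by auto
  have "{x, u} \<in> E" "{y, w} \<in> E"
    using uw by (simp_all add: insert_commute)
  hence "\<forall>i\<in>{0, 1, 2, 3}. {[x, u, y, w] ! i, [x, u, y, w] ! (Suc i mod 4)} \<in> E"
    using uw by simp
  moreover have "{i. i < 4} = {0, 1, 2, 3 :: nat}"
    by auto
  ultimately have "\<forall>i<4. {[x, u, y, w] ! i, [x, u, y, w] ! (Suc i mod 4)} \<in> E"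
    by blast
  hence "is_cycle E [x, u, y, w]"
    using uw(1) ne assms(2) by (auto simp: is_cycle_def)
  hence "girth E \<le> enat (length [x, u, y, w])"
    unfolding girth_def by (intro INF_lower) simp
  moreover have "enat 4 < 5"
    by (simp add: numeral_eq_enat)
  ultimately show False
    using assms(1) by (simp add: eval_nat_numeral)
qed

text \<open>Counting the pairs of neighbours of each vertex: two distinct vertices have at most one
  common neighbour, and none if they are adjacent.\<close>

lemma card_edges_bound:
  assumes "triangle_free E" "girth E \<ge> 5"
  shows "4 * (card E)\<^sup>2 \<le> (card V)\<^sup>2 * (card V - 1)"
proof -
  define a where "a = (\<lambda>x y. if {x, y} \<in> E then 1 else 0 :: nat)"
  define d where "d = degree_in V"
  let ?n = "card V"
  have d: "d x = (\<Sum>u\<in>V. a u x)" if "x \<in> V" for x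
    using degree_in_nbrs[of V x] that finite_verts
    by (simp add: d_def a_def sum.If_cases Int_def)
  have a_sym: "a x y = a y x" for x y
    by (simp add: a_def insert_commute)
  have codeg: "(\<Sum>u\<in>V. a u x * a u y) + a x y \<le> (if x = y then d x else 1)"
    if x: "x \<in> V" for x y
  proof -
    have card: "(\<Sum>u\<in>V. a u x * a u y) = card {u \<in> V. {u, x} \<in> E \<and> {u, y} \<in> E}"
      unfolding a_def using finite_verts
      by (simp add: sum.If_cases Int_def if_distrib[where f = "\<lambda>z. z * _"] if_if_eq_conj cong: if_cong)
    show ?thesis
    proof (cases "x = y")
      case True
      have "(\<Sum>u\<in>V. a u x * a u y) = (\<Sum>u\<in>V. a u x)"
        using True by (intro sum.cong) (auto simp: a_def)
      moreover have "a x y = 0"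
        using True singleton_not_edge by (simp add: a_def)
      ultimately show ?thesis using True d[OF x] by simp
    next
      case False
      have "a x y = 0" if "{u, x} \<in> E" "{u, y} \<in> E" for u
        using assms(1) that unfolding a_def triangle_free_def by (metis insert_commute)
      hence "card {u \<in> V. {u, x} \<in> E \<and> {u, y} \<in> E} = 0 \<or> a x y = 0"
        by (metis (mono_tags, lifting) card.empty empty_Collect_eq)
      moreover have "a x y \<le> 1" by (simp add: a_def)
      ultimately show ?thesis
        using card card_common_nbrs[OF assms(2) False] False by auto
    qed
  qed
  have sum_d: "(\<Sum>x\<in>V. d x) = 2 * card E"
    using sum_degree_in[of V] by (simp add: d_def induced_verts)
  have "(\<Sum>u\<in>V. (d u)\<^sup>2) = (\<Sum>u\<in>V. \<Sum>x\<in>V. \<Sum>y\<in>V. a u x * a u y)"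
    by (intro sum.cong refl) (simp add: d power2_eq_square sum_product a_sym)
  also have "\<dots> = (\<Sum>x\<in>V. \<Sum>u\<in>V. \<Sum>y\<in>V. a u x * a u y)"
    by (rule sum.swap)
  also have "\<dots> = (\<Sum>x\<in>V. \<Sum>y\<in>V. \<Sum>u\<in>V. a u x * a u y)"
    by (intro sum.cong refl sum.swap)
  finally have sq: "(\<Sum>u\<in>V. (d u)\<^sup>2) = (\<Sum>x\<in>V. \<Sum>y\<in>V. \<Sum>u\<in>V. a u x * a u y)" .
  have "(\<Sum>u\<in>V. (d u)\<^sup>2) + (\<Sum>x\<in>V. d x) = (\<Sum>x\<in>V. \<Sum>y\<in>V. (\<Sum>u\<in>V. a u x * a u y) + a x y)"
    unfolding sq by (simp add: sum.distrib d a_sym)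
  also have "\<dots> \<le> (\<Sum>x\<in>V. \<Sum>y\<in>V. if x = y then d x else 1)"
    using codeg by (intro sum_mono) auto
  also have "\<dots> = (\<Sum>x\<in>V. d x + (?n - 1))"
  proof (intro sum.cong refl)
    fix x assume x: "x \<in> V"
    have "(\<Sum>y\<in>V. if x = y then d x else 1) = d x + (\<Sum>y\<in>V - {x}. if x = y then d x else 1)"
      using x finite_verts by (simp add: sum.remove)
    also have "(\<Sum>y\<in>V - {x}. if x = y then d x else 1) = (\<Sum>y\<in>V - {x}. 1)"
      by (intro sum.cong) auto
    finally show "(\<Sum>y\<in>V. if x = y then d x else 1) = d x + (?n - 1)"
      using x finite_verts by simp
  qed
  \<comment> \<open>The degree sum stands on both sides, from adjacent pairs on the left and from
    the diagonal on the right, and cancels.\<close>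
  finally have "(\<Sum>u\<in>V. (d u)\<^sup>2) \<le> ?n * (?n - 1)"
    by (simp add: sum.distrib)
  hence "real (\<Sum>u\<in>V. (d u)\<^sup>2) \<le> real (?n * (?n - 1))"
    by (rule of_nat_mono)
  hence le: "(\<Sum>u\<in>V. (real (d u))\<^sup>2) \<le> real (?n * (?n - 1))"
    by simp
  have "(2 * real (card E))\<^sup>2 = (\<Sum>u\<in>V. real (d u))\<^sup>2"
    using arg_cong[OF sum_d, of real] by simp
  also have "\<dots> \<le> (\<Sum>u\<in>V. (real (d u))\<^sup>2) * ?n"
    by (rule sum_squared_le_sum_of_squares)
  also have "\<dots> \<le> real (?n * (?n - 1)) * ?n"
    using le by (rule mult_right_mono) simp
  finally have "real ((2 * card E)\<^sup>2) \<le> real (?n * (?n - 1) * ?n)"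
    by (simp only: of_nat_mult of_nat_power of_nat_numeral)
  hence "(2 * card E)\<^sup>2 \<le> ?n * (?n - 1) * ?n"
    by (simp only: of_nat_le_iff)
  thus ?thesis
    by (simp add: power2_eq_square ac_simps)
qed

text \<open>The constant half suffices once \<open>25 * card E \<le> 2 * (card V)\<^sup>2\<close>.
  By the edge bound this follows from \<open>625 * (n - 1) \<le> 16 * n\<^sup>2\<close> for
  \<open>n = card V\<close>, which just fails at 38.\<close>

lemma beta_large:
  assumes "triangle_free E" "girth E \<ge> 5" "card V \<ge> 39"
  shows "beta V E \<le> 1 / 50"
proof -
  let ?n = "real (card V)" and ?e = "real (card E)"
  have "real (4 * (card E)\<^sup>2) \<le> real ((card V)\<^sup>2 * (card V - 1))"
    using card_edges_bound[OF assms(1,2)] by (rule of_nat_mono)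
  hence "4 * ?e\<^sup>2 \<le> ?n\<^sup>2 * (?n - 1)"
    using assms(3) by (simp add: of_nat_diff)
  also have "625 * (?n - 1) \<le> 16 * ?n\<^sup>2"
  proof -
    \<comment> \<open>The product expands to \<open>16 * n\<^sup>2 - 625 * n + 39\<close>, and
      \<open>39 \<le> 625\<close>.\<close>
    have "0 \<le> (?n - 39) * (16 * ?n - 1)"
      using assms(3) by (intro mult_nonneg_nonneg) auto
    thus ?thesis using assms(3) by (simp add: power2_eq_square algebra_simps)
  qed
  hence "?n\<^sup>2 * (625 * (?n - 1)) \<le> ?n\<^sup>2 * (16 * ?n\<^sup>2)"
    by (intro mult_left_mono) auto
  hence "?n\<^sup>2 * (?n - 1) \<le> ?n\<^sup>2 * (16 * ?n\<^sup>2) / 625"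
    by (simp add: algebra_simps)
  finally have "(25 * ?e)\<^sup>2 \<le> (2 * ?n\<^sup>2)\<^sup>2"
    by (simp add: power2_eq_square algebra_simps)
  hence "25 * ?e \<le> 2 * ?n\<^sup>2"
    by (rule power2_le_imp_le) simp
  hence "(?e / 4) / ?n\<^sup>2 \<le> 1 / 50"
    using assms(3) by (simp add: field_simps)
  moreover have "V \<noteq> {}"
    using assms(3) by auto
  ultimately show ?thesis
    using beta_uniform_half by fastforce
qed

section \<open>Orders below 39\<close>

text \<open>On \<open>11\<close> vertices the generic initial bound is too weak: here a set of 7 vertices spanning
  5 edges is excluded by deleting one vertex and half of another one.\<close>

lemma valid_bounds_11:
  assumes "triangle_free E" "beta V E > 1 / 50" "card V = 11"
  shows "valid_bounds 7 [6, 3]"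
proof -
  have s6: "spans 6 3"
    using spans_half_odd[OF assms(2), of 6] assms(3) by simp
  have "6 \<le> card (induced W)" if W: "W \<subseteq> V" "card W = 7" for W
  proof -
    have ge: "5 \<le> card (induced W)"
      using spans_average[OF s6 W(1)] W(2) by simp
    have "card (induced W) \<noteq> 5"
    proof
      assume e: "card (induced W) = 5"
      have "degree_in W v \<le> 2" if "v \<in> W" for v
        using spans_remove[OF s6 W(1) _ that] W(2) e by simp
      \<comment> \<open>The degree sum 10 on 7 vertices of degree at most 2 forces three vertices of
        degree 2, two of them nonadjacent.\<close>
      hence "\<exists>I\<subseteq>W. card I = 2 \<and> independent I \<and> (\<forall>v\<in>I. degree_in W v = 2)"
        using e W by (intro ex_independent_max_degree[OF assms(1) W(1)]) auto
      then obtain I where I: "I \<subseteq> W" "card I = 2" "independent I" "\<forall>v\<in>I. degree_in W v = 2"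
        by blast
      then obtain u v where uv: "I = {u, v}" "u \<noteq> v"
        by (meson card_2_iff)
      have "degree_in (W - {u}) v = degree_in W v"
        using I(3) uv by (intro degree_in_minus_nonadjacent) (auto simp: independent_def)
      moreover have "card (induced W) = card (induced (W - {u})) + degree_in W u"
        by (rule card_induced_remove)
      \<comment> \<open>Three edges remain and \<open>v\<close> keeps degree 2, so this reads
        \<open>5 + 2 \<le> 6\<close>.\<close>
      moreover have "121 div 25 + 1 + degree_in (W - {u}) v \<le> 2 * card (induced (W - {u}))"
        using half_odd_bound[OF assms(2), of 6 "W - {u}" v] assms(3) W I(1) uv by auto
      ultimately show False
        using I(4) uv e by simp
    qed
    with ge show ?thesis by simp
  qed
  hence "spans 7 6" by (simp add: spans_def)
  with s6 show ?thesis
    by (auto simp: valid_bounds_def less_Suc_eq_0_disj)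
qed

lemma card_edges_ge_bounds:
  assumes "triangle_free E" "valid_bounds m ts" "2 \<le> m" "m \<le> card V"
  shows "hd (bounds m ts (card V - m)) \<le> card E"
proof -
  have "valid_bounds (card V) (bounds m ts (card V - m))"
    using valid_bounds_bounds[OF assms(1-3), of "card V - m"] assms(4) by simp
  hence "spans (card V) (hd (bounds m ts (card V - m)))"
    by (auto simp: valid_bounds_def hd_conv_nth)
  thus ?thesis
    using induced_verts by (auto simp: spans_def)
qed

end

text \<open>The bounds of \<open>spans_half\<close> and \<open>spans_half_odd\<close> for
  \<open>(n + 1) div 2\<close> vertices.\<close>

definition initial_bound :: "nat \<Rightarrow> nat" where
  "initial_bound n = (if even n then n\<^sup>2 div 50 + 1
     else ((n + 1) div 2 * (n\<^sup>2 div 25 + 1) + n - 2) div (n - 1))"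

text \<open>Four steps lead from 7 to 11 vertices; the result contradicts
  \<open>card_edges_bound\<close>.\<close>

lemma bounds_exceed_11: "11\<^sup>2 * (11 - 1) < 4 * (hd (bounds 7 [6, 3] 4))\<^sup>2"
  by (simp add: bounds.simps next_bound_def excluded_def Let_def)

lemma bounds_exceed:
  assumes "3 \<le> n" "n \<le> 38" "n \<noteq> 11"
  shows "n\<^sup>2 * (n - 1) < 4 * (hd (bounds ((n + 1) div 2) [initial_bound n] (n - (n + 1) div 2)))\<^sup>2"
proof -
  have "\<forall>n\<in>set [3..<39]. n \<noteq> 11 \<longrightarrow>
      n\<^sup>2 * (n - 1) < 4 * (hd (bounds ((n + 1) div 2) [initial_bound n] (n - (n + 1) div 2)))\<^sup>2"
    by code_simp
  moreover have "n \<in> set [3..<39]"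
    unfolding set_upt atLeastLessThan_iff using assms by linarith
  ultimately show ?thesis using assms(3) by blast
qed

theorem theorem3p8:
  fixes V :: "'a set" and E :: "'a set set"
  assumes "simple_graph V E"
    and "V \<noteq> {}"
    and "triangle_free E"
    and "girth E \<ge> 5"
  shows "beta V E \<le> 1 / 50"
proof (rule ccontr)
  interpret simple_graph V E by fact
  assume "\<not> ?thesis"
  hence dense: "beta V E > 1 / 50" by simp
  let ?n = "card V"
  have "?n > 0"
    using assms(2) finite_verts by (simp add: card_gt_0_iff)
  have le: "?n \<le> 38"
    using beta_large[OF assms(3,4)] dense by fastforce
  \<comment> \<open>Orders 1 and 2 are treated apart: the recursion starts at
    \<open>(n + 1) div 2\<close> vertices, and its correctness requires at least 2. For order 1 the
    edge bound forces \<open>card E = 0\<close>.\<close>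
  have "?n \<noteq> 1"
    using card_edges_bound[OF assms(3,4)] beta_uniform_half[OF assms(2)] dense by auto
  moreover have "?n \<noteq> 2"
  proof
    assume n: "?n = 2"
    \<comment> \<open>With \<open>spans 1 1\<close>, averaging over \<open>V\<close> reads
      \<open>2 + 2 * card E \<le> 2 * card E\<close>.\<close>
    show False
      using spans_average[OF spans_half[OF dense, of 1], of V] n by simp
  qed
  ultimately have ge: "?n \<ge> 3"
    using \<open>?n > 0\<close> by simp
  have no_bound: "\<not> ?n\<^sup>2 * (?n - 1) < 4 * s\<^sup>2" if "s \<le> card E" for s
  proof -
    have "4 * s\<^sup>2 \<le> 4 * (card E)\<^sup>2"
      using that by (simp add: power_mono)
    with card_edges_bound[OF assms(3,4)] show ?thesis by linarith
  qed
  show False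
  proof (cases "?n = 11")
    case True
    have "hd (bounds 7 [6, 3] 4) \<le> card E"
      using card_edges_ge_bounds[OF assms(3) valid_bounds_11[OF assms(3) dense True]] True by simp
    from no_bound[OF this] show False
      using bounds_exceed_11 True by simp
  next
    case False
    define h where "h = (?n + 1) div 2"
    have h: "2 \<le> h" "h \<le> ?n"
      using ge by (auto simp: h_def)
    have "spans h (initial_bound ?n)"
    proof (cases "even ?n")
      case True
      hence "?n = 2 * h" by (auto simp: h_def)
      thus ?thesis
        using spans_half[OF dense] True h by (simp add: initial_bound_def)
    next
      case odd: False
      hence "?n + 1 = 2 * h" by (auto simp: h_def)
      thus ?thesis
        using spans_half_odd[OF dense, of h] odd h unfolding initial_bound_def h_def by simp
    qed
    hence "valid_bounds h [initial_bound ?n]"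
      by (simp add: valid_bounds_def)
    hence "hd (bounds h [initial_bound ?n] (?n - h)) \<le> card E"
      using h by (intro card_edges_ge_bounds[OF assms(3)])
    from no_bound[OF this] show False
      using bounds_exceed[OF ge le False] by (simp add: h_def)
  qed
qed

end
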